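(* For every real $\eta>0$ and every integer $\Delta\ge2$ there exist positive constants $\beta$ and $\kappa$ such that for all sufficiently large $n$, for every graph $H\in\mathcal{H}_2^{\beta n}((1-\eta)n,\Delta)$ and every $k\le\kappa(n/\log n)^{1/\Delta}$, every $k$-bounded edge-colouring of the complete graph $K_n$ is $H$-polychromatic.
   Context: A graph on $m$ vertices has bandwidth at most $b$ if there is a bijective labelling of its vertices by $1,\dots,m$ such that $|i-j|\le b$ for every edge $ij$. $\mathcal{H}_2^{b}(m,\Delta)$ denotes the class of all bipartite graphs on $m$ vertices with maximum degree at most $\Delta$ and bandwidth at most $b$. An edge colouring $\phi$ of $K_n$ is $k$-bounded if no colour is used on more than $k$ edges. A copy of $H$ in $K_n$ is polychromatic if no colour appears on more than one of its edges; $\phi$ is $H$-polychromatic if $K_n$ contains a polychromatic copy of $H$. *)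

theory Defs
  imports Complex_Main
begin

definition graph_on :: "nat \<Rightarrow> nat set set \<Rightarrow> bool" where
  "graph_on m E \<longleftrightarrow> (\<forall>e\<in>E. \<exists>u v. e = {u, v} \<and> u \<noteq> v \<and> u < m \<and> v < m)"

definition max_degree_le :: "nat \<Rightarrow> nat set set \<Rightarrow> nat \<Rightarrow> bool" where
  "max_degree_le m E D \<longleftrightarrow> (\<forall>v<m. card {e\<in>E. v \<in> e} \<le> D)"

definition bipartite_graph :: "nat \<Rightarrow> nat set set \<Rightarrow> bool" where
  "bipartite_graph m E \<longleftrightarrow> (\<exists>A \<subseteq> {..<m}. \<forall>e\<in>E. card (e \<inter> A) = 1)"

definition bandwidth_le :: "nat \<Rightarrow> nat set set \<Rightarrow> real \<Rightarrow> bool" where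
  "bandwidth_le m E b \<longleftrightarrow> (\<exists>\<sigma>. bij_betw \<sigma> {..<m} {..<m} \<and>
      (\<forall>u v. {u, v} \<in> E \<longrightarrow> \<bar>real (\<sigma> u) - real (\<sigma> v)\<bar> \<le> b))"

definition H2_class :: "real \<Rightarrow> nat \<Rightarrow> nat \<Rightarrow> nat set set set" where
  "H2_class b m D = {E. graph_on m E \<and> bipartite_graph m E \<and> max_degree_le m E D \<and> bandwidth_le m E b}"

definition Kn_edges :: "nat \<Rightarrow> nat set set" where
  "Kn_edges n = {{u, v} | u v. u < n \<and> v < n \<and> u \<noteq> v}"

definition k_bounded :: "nat \<Rightarrow> nat \<Rightarrow> (nat set \<Rightarrow> 'c) \<Rightarrow> bool" where
  "k_bounded n k \<phi> \<longleftrightarrow> (\<forall>c. card {e \<in> Kn_edges n. \<phi> e = c} \<le> k)"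

definition polychromatic_for :: "nat \<Rightarrow> (nat set \<Rightarrow> 'c) \<Rightarrow> nat \<Rightarrow> nat set set \<Rightarrow> bool" where
  "polychromatic_for n \<phi> m E \<longleftrightarrow> (\<exists>g. inj_on g {..<m} \<and> g ` {..<m} \<subseteq> {..<n} \<and>
      inj_on (\<lambda>e. \<phi> (g ` e)) E)"

end

theory Submission
  imports Defs "HOL-Library.FuncSet"
begin

text \<open>
  Embed \<open>H\<close> by a uniformly random injection of its vertices. The injection is polychromatic
  unless it extends some partial matching that sends two edges of \<open>H\<close> to two equally coloured
  edges of \<open>K\<^sub>n\<close>. For vertex-disjoint partial matchings these events are negatively dependent,
  by a swapping argument, so the lopsided Lovasz local lemma applies: a matching on \<open>s\<close> vertices
  has probability at most \<open>(2/n)\<^sup>s\<close>, and the bad matchings meeting a given one have total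
  probability \<open>O(k \<Delta>\<^sup>2 / n)\<close>. This tends to \<open>0\<close>, as \<open>k \<le> sqrt n\<close>.
\<close>

section \<open>The lopsided local lemma, by counting\<close>

text \<open>Induction on the number of avoided events, with weights twice the bounds
  \<open>p\<close>. Inequalities between cardinalities are multiplied out, so that no division by
  the size of a possibly empty condition occurs.\<close>

lemma lopsided_local_lemma:
  fixes p :: "'i \<Rightarrow> real" and A :: "'i \<Rightarrow> 'a set"
  assumes fin: "finite \<Omega>" "finite I" and ne: "\<Omega> \<noteq> {}"
    and neg: "\<And>i J. i \<in> I \<Longrightarrow> J \<subseteq> I \<Longrightarrow> (\<And>j. j \<in> J \<Longrightarrow> \<not> dep i j) \<Longrightarrow>
        card (A i \<inter> (\<Omega> - \<Union>(A ` J))) \<le> p i * card (\<Omega> - \<Union>(A ` J))"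
    and p: "\<And>i. i \<in> I \<Longrightarrow> 0 \<le> p i" "\<And>i. i \<in> I \<Longrightarrow> p i < 1/2"
    and sum: "\<And>i. i \<in> I \<Longrightarrow> (\<Sum>j\<in>{j\<in>I. dep i j}. p j) \<le> 1/4"
  shows "\<Omega> - \<Union>(A ` I) \<noteq> {}"
proof -
  define B where "B J = \<Omega> - \<Union>(A ` J)" for J
  have finB: "finite (B J)" for J
    using fin by (simp add: B_def)
  txt \<open>The multiplicative form of: the conditional probability of \<open>A i\<close> given that all
    \<open>A j\<close>, \<open>j \<in> J\<close>, fail is at most \<open>2 p i\<close>.\<close>
  have cond: "card (A i \<inter> B J) \<le> 2 * p i * card (B J)" if "J \<subseteq> I" "i \<in> I" for i J
    using that
  proof (induction "card J" arbitrary: i J rule: less_induct)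
    case less
    \<comment> \<open>\<open>neg\<close> controls \<open>A i\<close> given that all of
      \<open>K\<close> fails; the events in \<open>D\<close> have to be paid for by a union
      bound.\<close>
    define D where "D = {j\<in>J. dep i j}"
    define K where "K = {j\<in>J. \<not> dep i j}"
    have finJ: "finite J" using less.prems fin finite_subset by blast
    have finD: "finite D" using finJ by (simp add: D_def)
    have KI: "K \<subseteq> I" using less.prems by (auto simp: K_def)
    have step: "card (A j \<inter> B K) \<le> 2 * p j * card (B K)" if "j \<in> D" for j
    proof -
      have "K \<subset> J" using that by (auto simp: K_def D_def)
      then have "card K < card J" using finJ psubset_card_mono by blast
      then show ?thesis using less KI that by (auto simp: D_def)
    qed
    \<comment> \<open>A point that avoids \<open>K\<close> but not \<open>J\<close> lies in some
      \<open>A j\<close> with \<open>j\<close> in \<open>D\<close>. By the induction hypothesis such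
      points make up at most 2 * 1/4 of \<open>B K\<close>, so \<open>B J\<close> keeps at least
      half of it. This loss is the factor 2 in the claim.\<close>
    have "B K \<subseteq> B J \<union> (\<Union>j\<in>D. A j \<inter> B K)" by (auto simp: B_def K_def D_def)
    then have "card (B K) \<le> card (B J \<union> (\<Union>j\<in>D. A j \<inter> B K))"
      using finB finD by (intro card_mono) auto
    also have "\<dots> \<le> card (B J) + card (\<Union>j\<in>D. A j \<inter> B K)" by (rule card_Un_le)
    also have "\<dots> \<le> card (B J) + (\<Sum>j\<in>D. card (A j \<inter> B K))"
      using card_UN_le[OF finD, of "\<lambda>j. A j \<inter> B K"] by linarith
    finally have "real (card (B K)) \<le> card (B J) + (\<Sum>j\<in>D. real (card (A j \<inter> B K)))"
      by (metis of_nat_add of_nat_le_iff of_nat_sum)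
    also have "\<dots> \<le> card (B J) + (\<Sum>j\<in>D. 2 * p j * card (B K))"
      using step by (intro add_left_mono sum_mono) auto
    also have "(\<Sum>j\<in>D. 2 * p j * card (B K)) = 2 * card (B K) * (\<Sum>j\<in>D. p j)"
      unfolding sum_distrib_left by (intro sum.cong) auto
    also have "\<dots> \<le> 2 * card (B K) * (1/4)"
    proof -
      have "(\<Sum>j\<in>D. p j) \<le> (\<Sum>j\<in>{j\<in>I. dep i j}. p j)"
        using fin p less.prems by (intro sum_mono2) (auto simp: D_def)
      then show ?thesis using sum[OF less.prems(2)] by (intro mult_left_mono) auto
    qed
    finally have half: "card (B K) \<le> 2 * real (card (B J))" by simp
    have "card (A i \<inter> B J) \<le> card (A i \<inter> B K)"
      using finB by (intro card_mono) (auto simp: B_def K_def)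
    also have "card (A i \<inter> B K) \<le> p i * card (B K)"
      using neg[OF less.prems(2) KI] by (auto simp: B_def K_def)
    also have "\<dots> \<le> p i * (2 * card (B J))"
      using half p less.prems by (intro mult_left_mono) auto
    finally show ?case by simp
  qed
  \<comment> \<open>Events are added one at a time: as 2 * \<open>p i\<close> < 1, the next event
    cannot cover all of the nonempty \<open>B J\<close>.\<close>
  have "B J \<noteq> {}" if "J \<subseteq> I" "finite J" for J
    using that(2,1)
  proof (induction J rule: finite_induct)
    case empty
    then show ?case using ne by (simp add: B_def)
  next
    case (insert i J)
    then have pos: "card (B J) > 0" using finB by (auto simp: card_gt_0_iff)
    show ?case
    proof
      assume "B (insert i J) = {}"
      then have "A i \<inter> B J = B J" by (auto simp: B_def)
      then have "card (B J) \<le> 2 * p i * card (B J)" using cond[of J i] insert by auto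
      then show False using pos p(2)[of i] insert by auto
    qed
  qed
  then show ?thesis using fin by (auto simp: B_def)
qed

section \<open>Negative dependence for random injections\<close>

text \<open>Extensional functions make the sample space finite, and two of them that agree on
  \<open>X\<close> are equal.\<close>

definition injections :: "'a set \<Rightarrow> 'b set \<Rightarrow> ('a \<Rightarrow> 'b) set" where
  "injections X Y = {\<sigma> \<in> X \<rightarrow>\<^sub>E Y. inj_on \<sigma> X}"

definition extensions :: "('a \<times> 'b) set \<Rightarrow> ('a \<Rightarrow> 'b) set" where
  "extensions M = {\<sigma>. \<forall>(x, y)\<in>M. \<sigma> x = y}"

definition partial_matching :: "'a set \<Rightarrow> 'b set \<Rightarrow> ('a \<times> 'b) set \<Rightarrow> bool" where
  "partial_matching X Y M \<longleftrightarrow> M \<subseteq> X \<times> Y \<and> inj_on fst M \<and> inj_on snd M"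

text \<open>This is the dependency relation for the local lemma. A nonempty matching meets itself,
  so its own weight counts in the dependency sum and it is never among the events conditioned
  on.\<close>

definition meets :: "('a \<times> 'b) set \<Rightarrow> ('a \<times> 'b) set \<Rightarrow> bool" where
  "meets M M' \<longleftrightarrow> fst ` M \<inter> fst ` M' \<noteq> {} \<or> snd ` M \<inter> snd ` M' \<noteq> {}"

lemma finite_injections: "finite X \<Longrightarrow> finite Y \<Longrightarrow> finite (injections X Y)"
  unfolding injections_def by (intro finite_subset[OF _ finite_PiE[of X "\<lambda>_. Y"]]) auto

text \<open>\<open>A\<close> and \<open>B\<close> have equal size, hence so do \<open>A - B\<close>
  and \<open>B - A\<close>. The permutation follows \<open>f\<close> on \<open>A\<close>, returns
  \<open>B - A\<close> to \<open>A - B\<close> by any bijection, and fixes the rest.\<close>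

lemma exists_swap:
  assumes "finite A" "bij_betw f A B"
  shows "\<exists>\<pi>. inj \<pi> \<and> (\<forall>y\<in>A. \<pi> y = f y) \<and> (\<forall>y. y \<notin> A \<union> B \<longrightarrow> \<pi> y = y) \<and>
    (\<forall>y\<in>B - A. \<pi> y \<in> A - B)"
proof -
  have fB: "finite B" and cAB: "card A = card B"
    using assms bij_betw_finite bij_betw_same_card by blast+
  have "card (B - A) = card (A - B)"
    using assms(1) fB cAB by (simp add: card_Diff_subset_Int Int_commute)
  then obtain h where h: "bij_betw h (B - A) (A - B)"
    using assms(1) fB by (metis bij_betw_iff_card finite_Diff)
  let ?\<pi> = "\<lambda>y. if y \<in> A then f y else if y \<in> B then h y else y"
  have fA: "f y \<in> B" if "y \<in> A" for y using assms(2) that by (auto simp: bij_betw_def)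
  have hA: "h y \<in> A - B" if "y \<in> B" "y \<notin> A" for y using h that by (auto simp: bij_betw_def)
  have injs: "inj_on f A" "inj_on h (B - A)" using assms(2) h by (auto simp: bij_betw_def)
  have "inj ?\<pi>"
  proof (rule injI)
    fix y z assume eq: "?\<pi> y = ?\<pi> z"
    show "y = z"
      using eq fA[of y] fA[of z] hA[of y] hA[of z] inj_onD[OF injs(1), of y z]
        inj_onD[OF injs(2), of y z]
      by (auto split: if_splits)
  qed
  then show ?thesis using hA by (intro exI[of _ ?\<pi>]) auto
qed

lemma extensions_negatively_dependent:
  assumes fin: "finite X" "finite Y" and M: "partial_matching X Y M"
    and F: "\<And>M'. M' \<in> F \<Longrightarrow> partial_matching X Y M' \<and> \<not> meets M M'"
  shows "card (extensions M \<inter> (injections X Y - \<Union>(extensions ` F))) * card (injections (fst ` M) Y)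
    \<le> card (injections X Y - \<Union>(extensions ` F))"
proof -
  let ?D = "fst ` M" and ?A = "snd ` M" and ?S = "injections X Y - \<Union>(extensions ` F)"
  have finM: "finite M"
    using M fin finite_subset[of M "X \<times> Y"] by (auto simp: partial_matching_def)
  have DX: "?D \<subseteq> X" and AY: "?A \<subseteq> Y" using M by (auto simp: partial_matching_def)
  \<comment> \<open>The last clause is the crucial one: a value outside \<open>?A\<close> is either
    fixed or moved into \<open>?A\<close>, so no new value outside \<open>?A\<close> arises from
    it.\<close>
  define swap where "swap \<tau> \<pi> \<longleftrightarrow> inj \<pi> \<and> (\<forall>(x, y)\<in>M. \<pi> y = \<tau> x) \<and> (\<forall>y\<in>Y. \<pi> y \<in> Y) \<and>
      (\<forall>y. y \<notin> ?A \<longrightarrow> \<pi> y \<notin> ?A \<longrightarrow> \<pi> y = y)" for \<tau> \<pi>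
  have "\<exists>\<pi>. swap \<tau> \<pi>"
    if \<tau>: "\<tau> \<in> injections ?D Y" for \<tau>
  proof -
    \<comment> \<open>\<open>M\<close> is read backwards, which makes sense because
      \<open>snd\<close> is injective on it: the value paired with \<open>x\<close> is sent to
      \<open>\<tau> x\<close>.\<close>
    define f where "f = (\<lambda>y. \<tau> (fst (inv_into M snd y)))"
    have f: "f y = \<tau> x" if "(x, y) \<in> M" for x y
      using M that inv_into_f_f[of snd M "(x, y)"] by (simp add: f_def partial_matching_def)
    have "bij_betw f ?A (\<tau> ` ?D)"
    proof (rule bij_betw_imageI)
      show "inj_on f ?A"
      proof (rule inj_onI)
        fix y z assume "y \<in> ?A" "z \<in> ?A" and eq: "f y = f z"
        then obtain u v where uv: "(u, y) \<in> M" "(v, z) \<in> M" by force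
        then have "\<tau> u = \<tau> v" using eq f by simp
        then have "u = v" using \<tau> uv by (force simp: injections_def dest: inj_onD)
        then show "y = z" using M uv inj_onD[of fst M "(u, y)" "(v, z)"] by (simp add: partial_matching_def)
      qed
      show "f ` ?A = \<tau> ` ?D" using f by (force simp: image_iff)
    qed
    from exists_swap[OF finite_imageI[OF finM] this] obtain \<pi> where "inj \<pi>"
      "\<forall>y\<in>?A. \<pi> y = f y" "\<forall>y. y \<notin> ?A \<union> \<tau> ` ?D \<longrightarrow> \<pi> y = y"
      "\<forall>y\<in>\<tau> ` ?D - ?A. \<pi> y \<in> ?A - \<tau> ` ?D"
      by (elim exE conjE)
    note \<pi> = this(1) this(2)[rule_format] this(3)[rule_format] this(4)[rule_format]
    have \<tau>Y: "\<tau> x \<in> Y" if "x \<in> ?D" for x using \<tau> that by (auto simp: injections_def)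
    have "\<pi> y \<in> Y" if "y \<in> Y" for y
    proof (cases "y \<in> ?A")
      case True
      then show ?thesis using \<pi>(2) f \<tau>Y by force
    next
      case False
      show ?thesis
      proof (cases "y \<in> \<tau> ` ?D")
        case True
        then have "\<pi> y \<in> ?A" using \<pi>(4)[of y] False by simp
        then show ?thesis using AY by blast
      next
        case False
        then show ?thesis using \<pi>(3)[of y] \<open>y \<notin> ?A\<close> that by simp
      qed
    qed
    moreover have "\<forall>(x, y)\<in>M. \<pi> y = \<tau> x" using \<pi>(2) f by force
    moreover have "\<forall>y. y \<notin> ?A \<longrightarrow> \<pi> y \<notin> ?A \<longrightarrow> \<pi> y = y" using \<pi>(3,4) by (metis Diff_iff Un_iff)
    ultimately show ?thesis using \<pi>(1) unfolding swap_def by blast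
  qed
  then obtain \<pi> where sw: "\<And>\<tau>. \<tau> \<in> injections ?D Y \<Longrightarrow> swap \<tau> (\<pi> \<tau>)"
    by metis
  have \<pi>: "inj (\<pi> \<tau>)" "\<And>x y. (x, y) \<in> M \<Longrightarrow> \<pi> \<tau> y = \<tau> x" "\<And>y. y \<in> Y \<Longrightarrow> \<pi> \<tau> y \<in> Y"
    "\<And>y. y \<notin> ?A \<Longrightarrow> \<pi> \<tau> y \<notin> ?A \<Longrightarrow> \<pi> \<tau> y = y" if "\<tau> \<in> injections ?D Y" for \<tau>
    using sw[OF that] by (auto simp: swap_def)
  txt \<open>Composing with the swap turns an extension of \<open>M\<close> into an extension of \<open>\<tau>\<close> and cannot
    create an extension of any matching disjoint from \<open>M\<close>.\<close>
  define g where "g = (\<lambda>(\<sigma>, \<tau>). restrict (\<pi> \<tau> \<circ> \<sigma>) X)"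
  have gM: "g (\<sigma>, \<tau>) x = \<tau> x"
    if "\<sigma> \<in> extensions M" "\<tau> \<in> injections ?D Y" "x \<in> ?D" for \<sigma> \<tau> x
    using that DX \<pi>(2) by (fastforce simp: g_def extensions_def)
  have "inj_on g ((extensions M \<inter> ?S) \<times> injections ?D Y)"
  proof (rule inj_onI, clarify, rule conjI)
    fix \<sigma> \<tau> \<sigma>' \<tau>'
    assume \<sigma>: "\<sigma> \<in> extensions M" "\<sigma> \<in> injections X Y" and \<tau>: "\<tau> \<in> injections ?D Y"
      and \<sigma>': "\<sigma>' \<in> extensions M" "\<sigma>' \<in> injections X Y" and \<tau>': "\<tau>' \<in> injections ?D Y"
      and eq: "g (\<sigma>, \<tau>) = g (\<sigma>', \<tau>')"
    have "\<tau> x = \<tau>' x" if "x \<in> ?D" for x using gM[OF \<sigma>(1) \<tau> that] gM[OF \<sigma>'(1) \<tau>' that] eq by simp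
    then show *: "\<tau> = \<tau>'" using \<tau> \<tau>' by (auto simp: injections_def intro: PiE_ext)
    have "\<sigma> x = \<sigma>' x" if "x \<in> X" for x
      using fun_cong[OF eq, of x] that \<pi>(1)[OF \<tau>] * by (auto simp: g_def dest: injD)
    then show "\<sigma> = \<sigma>'" using \<sigma> \<sigma>' by (auto simp: injections_def intro: PiE_ext)
  qed
  moreover have "g ` ((extensions M \<inter> ?S) \<times> injections ?D Y) \<subseteq> ?S"
  proof clarify
    fix \<sigma> \<tau>
    assume \<sigma>: "\<sigma> \<in> extensions M" "\<sigma> \<in> injections X Y" "\<sigma> \<notin> \<Union>(extensions ` F)"
      and \<tau>: "\<tau> \<in> injections ?D Y"
    have "g (\<sigma>, \<tau>) \<in> X \<rightarrow>\<^sub>E Y"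
      using \<sigma>(2) \<pi>(3)[OF \<tau>] by (auto simp: g_def injections_def dest: PiE_mem)
    moreover have "inj_on (g (\<sigma>, \<tau>)) X"
      using \<sigma>(2) \<pi>(1)[OF \<tau>] by (auto simp: g_def injections_def inj_on_def)
    moreover have "g (\<sigma>, \<tau>) \<notin> extensions M'" if M': "M' \<in> F" for M'
    proof
      assume ext: "g (\<sigma>, \<tau>) \<in> extensions M'"
      have "\<sigma> x = y" if xy: "(x, y) \<in> M'" for x y
      proof -
        have x: "x \<in> X" "x \<notin> ?D" and y: "y \<notin> ?A"
          using F[OF M'] xy by (force simp: partial_matching_def meets_def)+
        \<comment> \<open>The values in \<open>?A\<close> are already taken by \<sigma> on the
          domain of \<open>M\<close>. Hence the swap carries \<open>\<sigma> x\<close>, which is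
          outside \<open>?A\<close>, to \<open>y\<close>, also outside \<open>?A\<close>, and must
          therefore fix it.\<close>
        have "\<sigma> x \<notin> ?A"
        proof
          assume "\<sigma> x \<in> ?A"
          then obtain u where u: "(u, \<sigma> x) \<in> M" by force
          then have "\<sigma> u = \<sigma> x" using \<sigma>(1) by (auto simp: extensions_def)
          moreover have "u \<in> ?D" using u by force
          ultimately show False using \<sigma>(2) x DX by (auto simp: injections_def dest: inj_onD)
        qed
        moreover have "\<pi> \<tau> (\<sigma> x) = y" using ext xy x by (auto simp: extensions_def g_def)
        ultimately show ?thesis using \<pi>(4)[OF \<tau>] y by metis
      qed
      then show False using \<sigma>(3) M' by (auto simp: extensions_def)
    qed
    ultimately show "g (\<sigma>, \<tau>) \<in> ?S" by (auto simp: injections_def)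
  qed
  moreover have "finite ?S" using fin by (simp add: finite_injections)
  ultimately show ?thesis
    using card_inj_on_le[of g "(extensions M \<inter> ?S) \<times> injections ?D Y" ?S]
    by (simp only: card_cartesian_product)
qed

text \<open>The count is a falling factorial, each of whose factors is at least half of
  \<open>card Y\<close>. With the previous lemma this yields the probability bound
  \<open>(2/n)^s\<close> for a matching of size \<open>s\<close>.\<close>

lemma card_injections_ge:
  assumes "finite X" "finite Y" "2 * card X \<le> card Y"
  shows "(card Y / 2) ^ card X \<le> real (card (injections X Y))"
proof -
  have "(card Y / 2) ^ card X = (\<Prod>i = 0..<card X. real (card Y) / 2)" by simp
  also have "\<dots> \<le> (\<Prod>i = 0..<card X. real (card Y - i))"
    using assms(3) by (intro prod_mono) (auto simp: of_nat_diff)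
  also have "\<dots> = real (card (injections X Y))"
    using card_inj_on_subset_funcset[OF assms(1,2) subset_refl] by (simp add: injections_def)
  finally show ?thesis .
qed

section \<open>Counting bad matchings\<close>

text \<open>Finiteness is bundled with the bound because \<open>card\<close> is 0 on infinite sets;
  the pair is what passes through nested unions.\<close>

definition finite_card_le :: "'a set \<Rightarrow> nat \<Rightarrow> bool" where
  "finite_card_le A k \<longleftrightarrow> finite A \<and> card A \<le> k"

lemma finite_card_le_UN:
  assumes "finite_card_le I p" "\<And>i. i \<in> I \<Longrightarrow> finite_card_le (A i) q"
  shows "finite_card_le (\<Union>i\<in>I. A i) (p * q)"
proof -
  have "card (\<Union>i\<in>I. A i) \<le> (\<Sum>i\<in>I. card (A i))"
    using assms by (intro card_UN_le) (auto simp: finite_card_le_def)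
  also have "\<dots> \<le> card I * q"
    using assms sum_bounded_above[of I "\<lambda>i. card (A i)" q] by (auto simp: finite_card_le_def)
  also have "\<dots> \<le> p * q" using assms by (auto simp: finite_card_le_def)
  finally show ?thesis using assms by (auto simp: finite_card_le_def)
qed

lemma finite_card_le_UN_prod:
  assumes "finite_card_le I p" "\<And>x y. (x, y) \<in> I \<Longrightarrow> finite_card_le (A x y) q"
  shows "finite_card_le (\<Union>(x, y)\<in>I. A x y) (p * q)"
  using assms by (intro finite_card_le_UN) auto

lemma finite_card_le_subset: "finite_card_le B k \<Longrightarrow> A \<subseteq> B \<Longrightarrow> finite_card_le A k"
  by (meson card_mono finite_card_le_def finite_subset order_trans)

lemma finite_card_le_image: "finite_card_le A k \<Longrightarrow> finite_card_le (f ` A) k"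
  by (meson card_image_le finite_card_le_def finite_imageI order_trans)

lemma finite_card_le_singleton: "finite_card_le {a} 1"
  by (simp add: finite_card_le_def)

lemma finite_card_le_lessThan: "m \<le> n \<Longrightarrow> finite_card_le {..<m} n"
  by (simp add: finite_card_le_def)

definition nbrs :: "nat set set \<Rightarrow> nat \<Rightarrow> nat set" where
  "nbrs E u = {v. {u, v} \<in> E}"

text \<open>Ordered pairs are used because a matching says which end of an edge goes where; each
  edge thus counts twice.\<close>

definition arcs_coloured :: "nat \<Rightarrow> (nat set \<Rightarrow> 'c) \<Rightarrow> 'c \<Rightarrow> (nat \<times> nat) set" where
  "arcs_coloured n \<phi> c = {(u, v). u < n \<and> v < n \<and> u \<noteq> v \<and> \<phi> {u, v} = c}"

text \<open>The four pairs may coincide: two edges of \<open>E\<close> sharing a vertex give a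
  matching with three pairs.\<close>

definition bad_matchings :: "nat \<Rightarrow> nat \<Rightarrow> nat set set \<Rightarrow> (nat set \<Rightarrow> 'c) \<Rightarrow> (nat \<times> nat) set set" where
  "bad_matchings n m E \<phi> = {M. partial_matching {..<m} {..<n} M \<and>
     (\<exists>a b c d a' b' c' d'. M = {(a, a'), (b, b'), (c, c'), (d, d')} \<and>
        {a, b} \<in> E \<and> {c, d} \<in> E \<and> {a, b} \<noteq> {c, d} \<and> \<phi> {a', b'} = \<phi> {c', d'})}"

lemma graph_on_edgeD:
  assumes "graph_on m E" "{a, b} \<in> E"
  shows "a < m" "b < m" "a \<noteq> b"
proof -
  obtain u v where "{a, b} = {u, v}" "u \<noteq> v" "u < m" "v < m"
    using assms unfolding graph_on_def by meson
  then show "a < m" "b < m" "a \<noteq> b" by (auto simp: doubleton_eq_iff)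
qed

lemma finite_card_le_nbrs:
  assumes "graph_on m E" "max_degree_le m E D" "u < m"
  shows "finite_card_le (nbrs E u) D"
proof -
  have "E \<subseteq> Pow {..<m}" using assms(1) by (force simp: graph_on_def)
  then have "finite {e\<in>E. u \<in> e}" by (simp add: finite_subset)
  moreover have "inj_on (\<lambda>v. {u, v}) (nbrs E u)" by (auto simp: inj_on_def doubleton_eq_iff)
  moreover have "(\<lambda>v. {u, v}) ` nbrs E u \<subseteq> {e\<in>E. u \<in> e}" by (auto simp: nbrs_def)
  ultimately have "finite (nbrs E u)" "card (nbrs E u) \<le> card {e\<in>E. u \<in> e}"
    by (meson inj_on_finite, meson card_inj_on_le)
  then show ?thesis using assms(2,3) by (force simp: max_degree_le_def finite_card_le_def)
qed

lemma finite_card_le_arcs_coloured: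
  assumes "k_bounded n k \<phi>"
  shows "finite_card_le (arcs_coloured n \<phi> c) (k * 2)"
proof -
  let ?K = "{e \<in> Kn_edges n. \<phi> e = c}"
  have "Kn_edges n \<subseteq> Pow {..<n}" by (auto simp: Kn_edges_def)
  then have K: "finite_card_le ?K k"
    using assms by (auto simp: k_bounded_def finite_card_le_def intro: finite_subset)
  have two: "finite_card_le {(u, v). {u, v} = e} 2" if "e \<in> ?K" for e
  proof -
    obtain a b where "e = {a, b}" using \<open>e \<in> ?K\<close> by (auto simp: Kn_edges_def)
    then have "{(u, v). {u, v} = e} \<subseteq> {(a, b), (b, a)}" by (auto simp: doubleton_eq_iff)
    moreover have "finite_card_le {p, q} 2" for p q :: "nat \<times> nat"
      by (simp add: finite_card_le_def card_insert_if)
    ultimately show ?thesis by (meson finite_card_le_subset)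
  qed
  have "arcs_coloured n \<phi> c \<subseteq> (\<Union>e\<in>?K. {(u, v). {u, v} = e})"
    by (auto simp: arcs_coloured_def Kn_edges_def)
  with finite_card_le_UN[OF K two] show ?thesis by (rule finite_card_le_subset)
qed

text \<open>Fixing one end gains nothing over the whole colour class, since a colour may form a
  star.\<close>

lemma finite_card_le_arcs_coloured_from:
  assumes "k_bounded n k \<phi>"
  shows "finite_card_le {v. (u, v) \<in> arcs_coloured n \<phi> c} (k * 2)"
proof -
  have "{v. (u, v) \<in> arcs_coloured n \<phi> c} \<subseteq> snd ` arcs_coloured n \<phi> c" by force
  then show ?thesis
    using finite_card_le_arcs_coloured[OF assms] finite_card_le_image finite_card_le_subset by blast
qed

text \<open>The pattern is symmetric under exchanging the two edges and the ends of each, so any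
  pair can be put first.\<close>

lemma bad_matching_rotate:
  assumes "M \<in> bad_matchings n m E \<phi>" "(x, y) \<in> M"
  obtains b c d b' c' d' where "M = {(x, y), (b, b'), (c, c'), (d, d')}"
    "{x, b} \<in> E" "{c, d} \<in> E" "{x, b} \<noteq> {c, d}" "\<phi> {y, b'} = \<phi> {c', d'}"
proof -
  obtain a b c d a' b' c' d' where M: "M = {(a, a'), (b, b'), (c, c'), (d, d')}"
    and *: "{a, b} \<in> E" "{c, d} \<in> E" "{a, b} \<noteq> {c, d}" "\<phi> {a', b'} = \<phi> {c', d'}"
    using assms(1) unfolding bad_matchings_def by blast
  have "(x, y) = (a, a') \<or> (x, y) = (b, b') \<or> (x, y) = (c, c') \<or> (x, y) = (d, d')"
    using assms(2) M by auto
  then show ?thesis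
  proof (elim disjE)
    assume "(x, y) = (a, a')"
    then show ?thesis using that[of b b' c c' d d'] M * by simp
  next
    assume "(x, y) = (b, b')"
    then show ?thesis using that[of a a' c c' d d'] M * by (simp add: insert_commute)
  next
    assume "(x, y) = (c, c')"
    then show ?thesis using that[of d d' a a' b b'] M * by (auto simp: insert_commute)
  next
    assume "(x, y) = (d, d')"
    then show ?thesis using that[of c c' a a' b b'] M * by (auto simp: insert_commute)
  qed
qed

text \<open>The cases are disjoint edges, a common vertex \<open>x\<close>, and a common vertex
  \<open>b\<close> next to \<open>x\<close>. Each lists its data in the order in which they will be
  chosen: neighbours in \<open>E\<close>, free vertices, and finally vertices forced into one colour
  class.\<close>

lemma bad_matching_cases:
  assumes E: "graph_on m E" and M: "M \<in> bad_matchings n m E \<phi>" and xy: "(x, y) \<in> M"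
  obtains
    (four) b c d b' c' d' where "card M = 4" "M = {(x, y), (b, b'), (c, c'), (d, d')}"
      "b \<in> nbrs E x" "c < m" "d \<in> nbrs E c" "b' < n" "(c', d') \<in> arcs_coloured n \<phi> (\<phi> {y, b'})"
  | (three_centre) b d b' d' where "card M = 3" "M = {(x, y), (b, b'), (d, d')}"
      "b \<in> nbrs E x" "d \<in> nbrs E x" "b' < n" "(y, d') \<in> arcs_coloured n \<phi> (\<phi> {y, b'})"
  | (three_leaf) b d b' d' where "card M = 3" "M = {(x, y), (b, b'), (d, d')}"
      "b \<in> nbrs E x" "d \<in> nbrs E b" "b' < n" "(b', d') \<in> arcs_coloured n \<phi> (\<phi> {y, b'})"
proof -
  obtain b c d b' c' d' where Meq: "M = {(x, y), (b, b'), (c, c'), (d, d')}"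
    and e: "{x, b} \<in> E" and f: "{c, d} \<in> E" and ef: "{x, b} \<noteq> {c, d}"
    and col: "\<phi> {y, b'} = \<phi> {c', d'}"
    using bad_matching_rotate[OF M xy] .
  have pm: "M \<subseteq> {..<m} \<times> {..<n}" "inj_on fst M" "inj_on snd M"
    using M by (auto simp: bad_matchings_def partial_matching_def)
  have fn: "u' = v'" if "(u, u') \<in> M" "(u, v') \<in> M" for u u' v'
    using inj_onD[OF pm(2) _ that] by simp
  have inj': "u = v" if "(u, u') \<in> M" "(v, u') \<in> M" for u v u'
    using inj_onD[OF pm(3) _ that] by simp
  have ne: "x \<noteq> b" "c \<noteq> d" using graph_on_edgeD[OF E e] graph_on_edgeD[OF E f] by auto
  have ne': "y \<noteq> b'" "c' \<noteq> d'" using inj' ne Meq by blast+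
  have lt: "y < n" "b' < n" "c' < n" "d' < n" "c < m" using pm(1) Meq by auto
  have cM: "card M = card {x, b, c, d}"
    using card_image[OF pm(2)] Meq by simp
  \<comment> \<open>Different edges share at most one vertex; it is one of \<open>x\<close>,
    \<open>b\<close> and may be either end of the second edge.\<close>
  consider "c = x" | "d = x" | "c = b" | "d = b" | "c \<notin> {x, b}" "d \<notin> {x, b}" by blast
  then show ?thesis
  proof cases
    case 1
    then have "c' = y" using fn Meq by blast
    moreover have "d \<noteq> b" using ef 1 by auto
    moreover have "M = {(x, y), (b, b'), (d, d')}" using Meq 1 \<open>c' = y\<close> by auto
    moreover have "card M = 3" using cM 1 ne \<open>d \<noteq> b\<close> by (auto simp: card_insert_if)
    ultimately show ?thesis using 1 e f ne' lt col
      by (intro three_centre[of b b' d d']) (simp_all add: nbrs_def arcs_coloured_def)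
  next
    case 2
    then have "d' = y" using fn Meq by blast
    moreover have "c \<noteq> b" using ef 2 by auto
    moreover have "M = {(x, y), (b, b'), (c, c')}" using Meq 2 \<open>d' = y\<close> by auto
    moreover have "card M = 3" using cM 2 ne \<open>c \<noteq> b\<close> by (auto simp: card_insert_if)
    ultimately show ?thesis using 2 e f ne' lt col
      by (intro three_centre[of b b' c c'])
        (simp_all add: nbrs_def arcs_coloured_def insert_commute[of y c'] insert_commute[of x c])
  next
    case 3
    then have "c' = b'" using fn Meq by blast
    moreover have "d \<noteq> x" using ef 3 by auto
    moreover have "M = {(x, y), (b, b'), (d, d')}" using Meq 3 \<open>c' = b'\<close> by auto
    moreover have "card M = 3" using cM 3 ne \<open>d \<noteq> x\<close> by (auto simp: card_insert_if)
    ultimately show ?thesis using 3 e f ne' lt col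
      by (intro three_leaf[of b b' d d']) (simp_all add: nbrs_def arcs_coloured_def)
  next
    case 4
    then have "d' = b'" using fn Meq by blast
    moreover have "c \<noteq> x" using ef 4 by auto
    moreover have "M = {(x, y), (b, b'), (c, c')}" using Meq 4 \<open>d' = b'\<close> by auto
    moreover have "card M = 3" using cM 4 ne \<open>c \<noteq> x\<close> by (auto simp: card_insert_if)
    ultimately show ?thesis using 4 e f ne' lt col
      by (intro three_leaf[of b b' c c'])
        (simp_all add: nbrs_def arcs_coloured_def insert_commute[of b' c'] insert_commute[of b c])
  next
    case 5
    then have "card M = 4" using cM ne by (auto simp: card_insert_if)
    then show ?thesis using Meq e f ne' lt col
      by (intro four[of b b' c c' d d']) (simp_all add: nbrs_def arcs_coloured_def)
  qed
qed

text \<open>Starting from a pair in \<open>Z\<close>, a neighbour costs a factor \<open>D\<close>, a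
  free vertex \<open>n\<close> and an arc of prescribed colour \<open>2k\<close>. A matching with
  one pair fewer has one free choice of order \<open>n\<close> fewer and a weight larger by
  \<open>n/2\<close>, so both sizes contribute equally in order.\<close>

lemma sum_bad_matchings_hitting:
  assumes E: "graph_on m E" "max_degree_le m E D" and \<phi>: "k_bounded n k \<phi>"
    and mn: "m \<le> n" "0 < n" and Z: "Z \<subseteq> {..<m} \<times> {..<n}" "finite_card_le Z q"
  shows "(\<Sum>M\<in>{M\<in>bad_matchings n m E \<phi>. M \<inter> Z \<noteq> {}}. (2 / n) ^ card M) \<le> 64 * k * D\<^sup>2 * q / (real n)\<^sup>2"
proof -
  let ?G = "{M\<in>bad_matchings n m E \<phi>. M \<inter> Z \<noteq> {}}"
  let ?C = "\<lambda>y b'. arcs_coloured n \<phi> (\<phi> {y, b'})"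
  \<comment> \<open>\<open>F\<close> enumerates candidates with disjoint edges, \<open>T\<close>
    those with the common vertex at the pair from \<open>Z\<close>, and \<open>L\<close> those with
    it at the neighbour.\<close>
  define F where "F = (\<Union>(x, y)\<in>Z. \<Union>b\<in>nbrs E x. \<Union>c\<in>{..<m}. \<Union>d\<in>nbrs E c. \<Union>b'\<in>{..<n}. \<Union>(c', d')\<in>?C y b'.
    {{(x, y), (b, b'), (c, c'), (d, d')}})"
  define T where "T = (\<Union>(x, y)\<in>Z. \<Union>b\<in>nbrs E x. \<Union>d\<in>nbrs E x. \<Union>b'\<in>{..<n}. \<Union>d'\<in>{d'. (y, d') \<in> ?C y b'}.
    {{(x, y), (b, b'), (d, d')}})"
  define L where "L = (\<Union>(x, y)\<in>Z. \<Union>b\<in>nbrs E x. \<Union>d\<in>nbrs E b. \<Union>b'\<in>{..<n}. \<Union>d'\<in>{d'. (b', d') \<in> ?C y b'}.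
    {{(x, y), (b, b'), (d, d')}})"
  have nb: "finite_card_le (nbrs E u) D" if "u < m" for u
    using finite_card_le_nbrs[OF E that] .
  have nbm: "v < m" if "v \<in> nbrs E u" for u v
    using that graph_on_edgeD[OF E(1)] by (auto simp: nbrs_def)
  have ZD: "x < m" if "(x, y) \<in> Z" for x y using Z(1) that by auto
  have F: "finite_card_le F (q * (D * (n * (D * (n * (k * 2 * 1))))))"
    unfolding F_def
    apply (rule finite_card_le_UN_prod[OF Z(2)])
    apply (rule finite_card_le_UN[OF nb[OF ZD]], assumption)
    apply (rule finite_card_le_UN[OF finite_card_le_lessThan[OF mn(1)]])
    apply (rule finite_card_le_UN[OF nb], simp)
    apply (rule finite_card_le_UN[OF finite_card_le_lessThan[OF order_refl]])
    apply (rule finite_card_le_UN_prod[OF finite_card_le_arcs_coloured[OF \<phi>]])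
    apply (rule finite_card_le_singleton)
    done
  have T: "finite_card_le T (q * (D * (D * (n * (k * 2 * 1)))))"
    unfolding T_def
    apply (rule finite_card_le_UN_prod[OF Z(2)])
    apply (rule finite_card_le_UN[OF nb[OF ZD]], assumption)
    apply (rule finite_card_le_UN[OF nb[OF ZD]], assumption)
    apply (rule finite_card_le_UN[OF finite_card_le_lessThan[OF order_refl]])
    apply (rule finite_card_le_UN[OF finite_card_le_arcs_coloured_from[OF \<phi>]])
    apply (rule finite_card_le_singleton)
    done
  have L: "finite_card_le L (q * (D * (D * (n * (k * 2 * 1)))))"
    unfolding L_def
    apply (rule finite_card_le_UN_prod[OF Z(2)])
    apply (rule finite_card_le_UN[OF nb[OF ZD]], assumption)
    apply (rule finite_card_le_UN[OF nb[OF nbm]], assumption)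
    apply (rule finite_card_le_UN[OF finite_card_le_lessThan[OF order_refl]])
    apply (rule finite_card_le_UN[OF finite_card_le_arcs_coloured_from[OF \<phi>]])
    apply (rule finite_card_le_singleton)
    done
  have G: "(card M = 4 \<and> M \<in> F) \<or> (card M = 3 \<and> M \<in> T \<union> L)" if M: "M \<in> ?G" for M
  proof -
    obtain x y where xy: "(x, y) \<in> M" "(x, y) \<in> Z" using M by auto
    have "M \<in> bad_matchings n m E \<phi>" using M by simp
    from E(1) this xy(1) show ?thesis
    proof (cases rule: bad_matching_cases)
      case (four b c d b' c' d')
      have "M \<in> F" unfolding F_def
        by (rule UN_I[OF xy(2)], simp only: prod.case, rule UN_I[OF four(3)], rule UN_I[of c],
          simp add: four(4), rule UN_I[OF four(5)], rule UN_I[of b'], simp add: four(6),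
          rule UN_I[OF four(7)], simp add: four(2))
      then show ?thesis using four(1) by blast
    next
      case (three_centre b d b' d')
      have "M \<in> T" unfolding T_def
        by (rule UN_I[OF xy(2)], simp only: prod.case, rule UN_I[OF three_centre(3)],
          rule UN_I[OF three_centre(4)], rule UN_I[of b'], simp add: three_centre(5),
          rule UN_I[of d'], simp add: three_centre(6), simp add: three_centre(2))
      then show ?thesis using three_centre(1) by blast
    next
      case (three_leaf b d b' d')
      have "M \<in> L" unfolding L_def
        by (rule UN_I[OF xy(2)], simp only: prod.case, rule UN_I[OF three_leaf(3)],
          rule UN_I[OF three_leaf(4)], rule UN_I[of b'], simp add: three_leaf(5),
          rule UN_I[of d'], simp add: three_leaf(6), simp add: three_leaf(2))
      then show ?thesis using three_leaf(1) by blast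
    qed
  qed
  \<comment> \<open>The weight depends only on the size, so the sum splits into two constant
    sums.\<close>
  define G4 where "G4 = {M\<in>?G. card M = 4}"
  define G3 where "G3 = {M\<in>?G. card M = 3}"
  have "G4 \<subseteq> F"
  proof
    fix M assume "M \<in> G4"
    then have "M \<in> ?G" "card M = 4" by (simp_all add: G4_def)
    then show "M \<in> F" using G[of M] by linarith
  qed
  with F have G4: "finite_card_le G4 (q * (D * (n * (D * (n * (k * 2 * 1))))))"
    by (rule finite_card_le_subset)
  have "G3 \<subseteq> T \<union> L"
  proof
    fix M assume "M \<in> G3"
    then have "M \<in> ?G" "card M = 3" by (simp_all add: G3_def)
    then show "M \<in> T \<union> L" using G[of M] by linarith
  qed
  moreover have "finite_card_le (T \<union> L) (q * (D * (D * (n * (k * 2 * 1)))) + q * (D * (D * (n * (k * 2 * 1)))))"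
    using T L by (meson add_mono card_Un_le finite_UnI finite_card_le_def order_trans)
  ultimately have G3: "finite_card_le G3 (2 * (q * (D * (D * (n * (k * 2 * 1))))))"
    by (metis finite_card_le_subset mult_2)
  have "?G \<subseteq> G4 \<union> G3"
  proof
    fix M assume "M \<in> ?G"
    then show "M \<in> G4 \<union> G3" using G[of M] unfolding G4_def G3_def by auto
  qed
  then have "?G = G4 \<union> G3" unfolding G4_def G3_def by auto
  moreover have "G4 \<inter> G3 = {}" by (auto simp: G4_def G3_def)
  ultimately have "(\<Sum>M\<in>?G. (2 / real n) ^ card M) = (\<Sum>M\<in>G4. (2 / real n) ^ card M) + (\<Sum>M\<in>G3. (2 / real n) ^ card M)"
    using G4 G3 by (simp add: finite_card_le_def sum.union_disjoint)
  also have "\<dots> = card G4 * (2 / real n) ^ 4 + card G3 * (2 / real n) ^ 3"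
    by (simp add: G4_def G3_def)
  also have "\<dots> \<le> real (q * (D * (n * (D * (n * (k * 2 * 1)))))) * (2 / real n) ^ 4
      + real (2 * (q * (D * (D * (n * (k * 2 * 1)))))) * (2 / real n) ^ 3"
    using G4 G3 unfolding finite_card_le_def by (intro add_mono mult_right_mono of_nat_mono) simp_all
  \<comment> \<open>Size 4 contributes 2 * 16 = 32. Size 3 contributes 4 * 8 = 32, the 4 being 2 for
    the arcs times 2 for \<open>T\<close> and \<open>L\<close>.\<close>
  also have "\<dots> = 64 * k * D\<^sup>2 * q / (real n)\<^sup>2"
    using mn(2) by (simp add: field_simps power2_eq_square power4_eq_xxxx power3_eq_cube)
  finally show ?thesis by simp
qed

lemma finite_bad_matchings: "finite (bad_matchings n m E \<phi>)"
proof (rule finite_subset)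
  show "bad_matchings n m E \<phi> \<subseteq> Pow ({..<m} \<times> {..<n})"
    by (auto simp: bad_matchings_def partial_matching_def)
qed simp

lemma bad_matching_card:
  assumes "M \<in> bad_matchings n m E \<phi>"
  shows "finite M" "0 < card M" "card M \<le> 4"
proof -
  obtain a b c d where M: "M = {a, b, c, d}"
    using assms unfolding bad_matchings_def by blast
  show "finite M" "0 < card M" using M by (auto simp: card_gt_0_iff)
  show "card M \<le> 4" unfolding M by (simp add: card_insert_if)
qed

section \<open>The local lemma applied to a random embedding\<close>

text \<open>The matchings meeting a given one have total weight at most 64 * 8 * k * D^2 / n, and
  2048 = 4 * 512 brings this down to 1/4. The bound 8 on \<open>n\<close> gives room for matchings
  of size up to 4 in \<open>card_injections_ge\<close> and makes 2/n less than 1/2.\<close>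

lemma polychromatic_if_bounded:
  assumes E: "graph_on m E" "max_degree_le m E D" and \<phi>: "k_bounded n k \<phi>"
    and mn: "m \<le> n" "8 \<le> n" and k: "2048 * k * D\<^sup>2 \<le> n"
  shows "polychromatic_for n \<phi> m E"
proof -
  let ?X = "{..<m}" and ?Y = "{..<n}" and ?I = "bad_matchings n m E \<phi>"
  have pm: "partial_matching ?X ?Y M" if "M \<in> ?I" for M
    using that by (simp add: bad_matchings_def)
  have "injections ?X ?Y - \<Union>(extensions ` ?I) \<noteq> {}"
  proof (rule lopsided_local_lemma[where dep = meets and p = "\<lambda>M. (2 / real n) ^ card M"])
    show "finite (injections ?X ?Y)" by (simp add: finite_injections)
    show "finite ?I" by (rule finite_bad_matchings)
    have "restrict id ?X \<in> injections ?X ?Y" using mn by (auto simp: injections_def inj_on_def)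
    then show "injections ?X ?Y \<noteq> {}" by blast
  next
    fix M J assume M: "M \<in> ?I" and J: "J \<subseteq> ?I" and nd: "\<And>M'. M' \<in> J \<Longrightarrow> \<not> meets M M'"
    let ?S = "injections ?X ?Y - \<Union>(extensions ` J)"
    have c: "card (fst ` M) = card M"
      using pm[OF M] by (simp add: partial_matching_def card_image)
    have "(n / 2) ^ card M \<le> card (injections (fst ` M) ?Y)"
      using card_injections_ge[of "fst ` M" ?Y] bad_matching_card[OF M] mn c by simp
    then have "card (extensions M \<inter> ?S) * (n / 2) ^ card M
        \<le> real (card (extensions M \<inter> ?S)) * card (injections (fst ` M) ?Y)"
      by (rule mult_left_mono) simp
    also have "\<dots> \<le> card ?S"
      using extensions_negatively_dependent[of ?X ?Y M J] pm M J nd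
      by (metis (no_types, lifting) finite_lessThan of_nat_le_iff of_nat_mult subsetD)
    finally show "card (extensions M \<inter> ?S) \<le> (2 / real n) ^ card M * card ?S"
      using mn by (simp add: field_simps)
  next
    fix M assume M: "M \<in> ?I"
    show "0 \<le> (2 / real n) ^ card M" by simp
    have "(2 / real n) ^ card M \<le> (2 / real n) ^ 1"
      using bad_matching_card[OF M] mn by (intro power_decreasing) auto
    also have "\<dots> < 1 / 2" using mn by simp
    finally show "(2 / real n) ^ card M < 1 / 2" .
    \<comment> \<open>\<open>?Z\<close> is the union of the rows and columns of the grid through the
      pairs of \<open>M\<close>: a bad matching that meets \<open>M\<close> has a pair
      there.\<close>
    let ?Z = "fst ` M \<times> ?Y \<union> ?X \<times> snd ` M"
    have Z: "?Z \<subseteq> ?X \<times> ?Y" using pm[OF M] by (auto simp: partial_matching_def)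
    have "card ?Z \<le> card (fst ` M) * n + m * card (snd ` M)"
      using card_Un_le[of "fst ` M \<times> ?Y" "?X \<times> snd ` M"] by (simp add: card_cartesian_product)
    also have "\<dots> \<le> 4 * n + n * 4"
      using bad_matching_card[OF M] mn card_image_le[of M fst] card_image_le[of M snd]
      by (intro add_mono mult_mono) auto
    finally have "finite_card_le ?Z (8 * n)"
      using bad_matching_card[OF M] by (simp add: finite_card_le_def)
    have "(\<Sum>M'\<in>{M'\<in>?I. meets M M'}. (2 / real n) ^ card M') \<le>
        (\<Sum>M'\<in>{M'\<in>?I. M' \<inter> ?Z \<noteq> {}}. (2 / real n) ^ card M')"
    proof (rule sum_mono2)
      show "{M'\<in>?I. meets M M'} \<subseteq> {M'\<in>?I. M' \<inter> ?Z \<noteq> {}}"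
      proof clarify
        fix M' assume M': "M' \<in> ?I" "meets M M'" and emp: "M' \<inter> ?Z = {}"
        obtain x y where xy: "(x, y) \<in> M'" "x \<in> fst ` M \<or> y \<in> snd ` M"
          using M'(2) by (force simp: meets_def)
        moreover have "x < m" "y < n" using pm[OF M'(1)] xy(1) by (auto simp: partial_matching_def)
        ultimately have "(x, y) \<in> M' \<inter> ?Z" by auto
        then show False using emp by simp
      qed
    qed (simp_all add: finite_bad_matchings)
    also have "\<dots> \<le> 64 * k * D\<^sup>2 * (8 * n) / (real n)\<^sup>2"
      using sum_bad_matchings_hitting[OF E \<phi> mn(1) _ Z \<open>finite_card_le ?Z (8 * n)\<close>] mn by simp
    also have "\<dots> = real (2048 * k * D\<^sup>2) / (4 * n)" using mn by (simp add: field_simps power2_eq_square)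
    also have "\<dots> \<le> real n / (4 * n)" using k by (intro divide_right_mono of_nat_mono) simp_all
    also have "\<dots> = 1 / 4" using mn by simp
    finally show "(\<Sum>M'\<in>{M'\<in>?I. meets M M'}. (2 / real n) ^ card M') \<le> 1 / 4" .
  qed
  then obtain g where g: "g \<in> ?X \<rightarrow>\<^sub>E ?Y" "inj_on g ?X" and avoid: "\<And>M. M \<in> ?I \<Longrightarrow> g \<notin> extensions M"
    by (auto simp: injections_def)
  have "inj_on (\<lambda>e. \<phi> (g ` e)) E"
  proof (rule inj_onI, rule ccontr)
    fix e f assume ef: "e \<in> E" "f \<in> E" "\<phi> (g ` e) = \<phi> (g ` f)" "e \<noteq> f"
    obtain a b c d where e: "e = {a, b}" "a < m" "b < m" and f: "f = {c, d}" "c < m" "d < m"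
      using E(1) ef(1,2) unfolding graph_on_def by meson
    \<comment> \<open>A colour repeated under \<open>g\<close> makes the graph of \<open>g\<close>
      on the two edges a bad matching, and \<open>g\<close> extends it.\<close>
    let ?M = "{(a, g a), (b, g b), (c, g c), (d, g d)}"
    have "inj_on snd ?M" using inj_onD[OF g(2)] e f by (auto simp: inj_on_def)
    moreover have "inj_on fst ?M" by (auto simp: inj_on_def)
    moreover have "?M \<subseteq> ?X \<times> ?Y" using g(1) e f by auto
    ultimately have "partial_matching ?X ?Y ?M" by (simp add: partial_matching_def)
    moreover have "{a, b} \<in> E" "{c, d} \<in> E" "{a, b} \<noteq> {c, d}" "\<phi> {g a, g b} = \<phi> {g c, g d}"
      using ef e f by auto
    ultimately have "?M \<in> ?I" unfolding bad_matchings_def by blast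
    moreover have "g \<in> extensions ?M" by (simp add: extensions_def)
    ultimately show False using avoid by blast
  qed
  then show ?thesis using g unfolding polychromatic_for_def by (intro exI[of _ g]) auto
qed

section \<open>Choice of constants\<close>

theorem theorem3p1:
  "\<forall>(\<eta>::real) (\<Delta>::nat). \<eta> > 0 \<and> \<Delta> \<ge> 2 \<longrightarrow>
    (\<exists>\<beta>::real. \<exists>\<kappa>::real. \<beta> > 0 \<and> \<kappa> > 0 \<and>
      (\<exists>n0::nat. \<forall>n \<ge> n0. \<forall>(m::nat) E (k::nat) (\<phi>::nat set \<Rightarrow> 'c).
         m = nat \<lfloor>(1 - \<eta>) * real n\<rfloor> \<and> E \<in> H2_class (\<beta> * real n) m \<Delta> \<and>
         real k \<le> \<kappa> * (real n / ln (real n)) powr (1 / real \<Delta>) \<and>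
         k_bounded n k \<phi>
         \<longrightarrow> polychromatic_for n \<phi> m E))"
proof (intro allI impI, elim conjE)
  fix \<eta> :: real and \<Delta> :: nat
  assume \<eta>: "\<eta> > 0" and \<Delta>: "\<Delta> \<ge> 2"
  \<comment> \<open>The square ensures that \<open>sqrt n\<close> is at least 2048 * \<Delta>^2; the
    other factor \<open>sqrt n\<close> will bound \<open>k\<close>.\<close>
  let ?n0 = "max 8 ((2048 * \<Delta>\<^sup>2)\<^sup>2)"
  \<comment> \<open>The factors 1 are the witnesses for \<beta> and \<kappa>, written out so that
    the fact matches the instantiated goal.\<close>
  have main: "polychromatic_for n \<phi> m E"
    if n: "?n0 \<le> n" and m: "m = nat \<lfloor>(1 - \<eta>) * real n\<rfloor>" and E: "E \<in> H2_class (1 * real n) m \<Delta>"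
      and k: "real k \<le> 1 * (real n / ln (real n)) powr (1 / real \<Delta>)" and \<phi>: "k_bounded n k \<phi>"
    for n m E k and \<phi> :: "nat set \<Rightarrow> 'c"
  proof (rule polychromatic_if_bounded)
    show "graph_on m E" "max_degree_le m E \<Delta>" using E by (auto simp: H2_class_def)
    \<comment> \<open>If \<eta> exceeds 1 the floor is negative and \<open>nat\<close> turns it into
      0.\<close>
    have "(1 - \<eta>) * real n \<le> real n" using \<eta> by (simp add: mult_left_le_one_le algebra_simps)
    then show "m \<le> n" unfolding m by linarith
    show n8: "8 \<le> n" using n by simp
    \<comment> \<open>The logarithm is at least 1, so dividing by it does not increase
      \<open>n\<close>; then \<Delta> >= 2 bounds the exponent by 1/2.\<close>
    have "exp 1 \<le> real n" using exp_le n8 by linarith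
    then have "1 \<le> ln (real n)" using n8 by (simp add: ln_ge_iff)
    then have "real n / ln (real n) \<le> real n" by (simp add: divide_le_eq mult_le_cancel_left1)
    then have "(real n / ln (real n)) powr (1 / real \<Delta>) \<le> real n powr (1 / real \<Delta>)"
      using \<open>1 \<le> ln (real n)\<close> by (intro powr_mono2) auto
    also have "\<dots> \<le> real n powr (1 / 2)"
      using n8 \<Delta> by (intro powr_mono) (auto simp: field_simps)
    finally have k2: "real k \<le> sqrt n" using k n8 by (simp add: powr_half_sqrt)
    have "real (2048 * \<Delta>\<^sup>2) \<le> sqrt n"
    proof (rule real_le_rsqrt)
      have "(2048 * \<Delta>\<^sup>2)\<^sup>2 \<le> n" using n by simp
      then show "(real (2048 * \<Delta>\<^sup>2))\<^sup>2 \<le> real n" by (metis of_nat_le_iff of_nat_power)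
    qed
    with k2 have "real k * real (2048 * \<Delta>\<^sup>2) \<le> sqrt n * sqrt n" by (intro mult_mono) auto
    then have "real (2048 * k * \<Delta>\<^sup>2) \<le> real n" by (simp add: mult_ac)
    then show "2048 * k * \<Delta>\<^sup>2 \<le> n" by (simp only: of_nat_le_iff)
  qed (rule \<phi>)
  show "\<exists>\<beta>::real. \<exists>\<kappa>::real. \<beta> > 0 \<and> \<kappa> > 0 \<and>
      (\<exists>n0::nat. \<forall>n \<ge> n0. \<forall>(m::nat) E (k::nat) (\<phi>::nat set \<Rightarrow> 'c).
         m = nat \<lfloor>(1 - \<eta>) * real n\<rfloor> \<and> E \<in> H2_class (\<beta> * real n) m \<Delta> \<and>
         real k \<le> \<kappa> * (real n / ln (real n)) powr (1 / real \<Delta>) \<and>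
         k_bounded n k \<phi>
         \<longrightarrow> polychromatic_for n \<phi> m E)"
    by (rule exI[of _ 1], rule exI[of _ 1], intro conjI zero_less_one, rule exI[of _ ?n0],
      intro allI impI, elim conjE, rule main)
qed

end
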